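(* The little Bloch space $\mathcal B^0$ is the closure (in $\mathcal B$), with respect to $\|\cdot\|_{\mathcal B}$, of the set of quaternionic polynomials of the form $$P(q)=\sum_{k=0}^nq^ka_k,\qquad a_k\in\mathbb H.$$ In particular, $\mathcal B^0$ is separable.
   Context: $\mathbb H$ denotes the quaternions with real part coordinate $x_0$, $\mathbb S^2$ the sphere of purely imaginary unit quaternions, $\mathbb C(i)=\{x+iy:x,y\in\mathbb R\}$ for $i\in\mathbb S^2$, $\mathbb B$ the open unit ball of $\mathbb H$, $\mathbb B_i=\mathbb B\cap\mathbb C(i)$. A real differentiable function $f:\mathbb B\to\mathbb H$ is (left) slice regular if for every $i\in\mathbb S^2$, $\left(\frac{\partial}{\partial x}+i\frac{\partial}{\partial y}\right)f(x+iy)=0$ on $\mathbb B_i$. The slice regular Bloch space $\mathcal B$ is the space of slice regular functions $f$ on $\mathbb B$ with $\|f\|_{\mathcal B}:=|f(0)|+\sup_{q\in\mathbb B}(1-|q|^2)\left|\frac{\partial f}{\partial x_0}(q)\right|<\infty$. The slice regular little Bloch space $\mathcal B^0$ is the space of all $f\in\mathcal B$ such that $\lim_{|q|\nearrow1}(1-|q|^2)|\partial_{x_0}f(q)|=0$. *)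

theory Defs
  imports "HOL-Analysis.Analysis"
begin

section \<open>The real division algebra of quaternions\<close>

datatype quat = Quat (q0: real) (q1: real) (q2: real) (q3: real)

lemma quat_eq_iff: "x = y \<longleftrightarrow> q0 x = q0 y \<and> q1 x = q1 y \<and> q2 x = q2 y \<and> q3 x = q3 y"
  by (cases x; cases y) simp

instantiation quat :: ab_group_add
begin

definition "0 = Quat 0 0 0 0"
definition "x + y = Quat (q0 x + q0 y) (q1 x + q1 y) (q2 x + q2 y) (q3 x + q3 y)"
definition "- x = Quat (- q0 x) (- q1 x) (- q2 x) (- q3 x)"
definition "x - y = Quat (q0 x - q0 y) (q1 x - q1 y) (q2 x - q2 y) (q3 x - q3 y)" for x y :: quat

instance
  by standard
    (simp_all add: zero_quat_def plus_quat_def uminus_quat_def minus_quat_def)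

end

lemma quat_add_simps [simp]:
  "q0 0 = 0" "q1 0 = 0" "q2 0 = 0" "q3 0 = 0"
  "q0 (x + y) = q0 x + q0 y" "q1 (x + y) = q1 x + q1 y"
  "q2 (x + y) = q2 x + q2 y" "q3 (x + y) = q3 x + q3 y"
  "q0 (- x) = - q0 x" "q1 (- x) = - q1 x" "q2 (- x) = - q2 x" "q3 (- x) = - q3 x"
  "q0 (x - y) = q0 x - q0 y" "q1 (x - y) = q1 x - q1 y"
  "q2 (x - y) = q2 x - q2 y" "q3 (x - y) = q3 x - q3 y"
  by (simp_all add: zero_quat_def plus_quat_def uminus_quat_def minus_quat_def)

instantiation quat :: ring_1
begin

definition "1 = Quat 1 0 0 0"
definition "x * y = Quat
  (q0 x * q0 y - q1 x * q1 y - q2 x * q2 y - q3 x * q3 y)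
  (q0 x * q1 y + q1 x * q0 y + q2 x * q3 y - q3 x * q2 y)
  (q0 x * q2 y - q1 x * q3 y + q2 x * q0 y + q3 x * q1 y)
  (q0 x * q3 y + q1 x * q2 y - q2 x * q1 y + q3 x * q0 y)"

instance
  by standard (simp_all add: quat_eq_iff one_quat_def times_quat_def algebra_simps)

end

lemma quat_mult_simps [simp]:
  "q0 1 = 1" "q1 1 = 0" "q2 1 = 0" "q3 1 = 0"
  "q0 (x * y) = q0 x * q0 y - q1 x * q1 y - q2 x * q2 y - q3 x * q3 y"
  "q1 (x * y) = q0 x * q1 y + q1 x * q0 y + q2 x * q3 y - q3 x * q2 y"
  "q2 (x * y) = q0 x * q2 y - q1 x * q3 y + q2 x * q0 y + q3 x * q1 y"
  "q3 (x * y) = q0 x * q3 y + q1 x * q2 y - q2 x * q1 y + q3 x * q0 y"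
  by (simp_all add: one_quat_def times_quat_def)

instantiation quat :: real_algebra_1
begin

definition "r *\<^sub>R x = Quat (r * q0 x) (r * q1 x) (r * q2 x) (r * q3 x)"

instance
  by standard (simp_all add: quat_eq_iff scaleR_quat_def algebra_simps)

end

lemma quat_scaleR_simps [simp]:
  "q0 (r *\<^sub>R x) = r * q0 x" "q1 (r *\<^sub>R x) = r * q1 x"
  "q2 (r *\<^sub>R x) = r * q2 x" "q3 (r *\<^sub>R x) = r * q3 x"
  by (simp_all add: scaleR_quat_def)

lemma quat_of_real_simps [simp]:
  "q0 (of_real r) = r" "q1 (of_real r) = 0" "q2 (of_real r) = 0" "q3 (of_real r) = 0"
  by (simp_all add: of_real_def)

lemma quat_sum_squares_eq_0_iff:
  "(q0 x)\<^sup>2 + (q1 x)\<^sup>2 + (q2 x)\<^sup>2 + (q3 x)\<^sup>2 = 0 \<longleftrightarrow> x = 0"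
  by (simp add: quat_eq_iff add_nonneg_eq_0_iff)

instantiation quat :: division_ring
begin

definition "inverse x =
  (1 / ((q0 x)\<^sup>2 + (q1 x)\<^sup>2 + (q2 x)\<^sup>2 + (q3 x)\<^sup>2)) *\<^sub>R Quat (q0 x) (- q1 x) (- q2 x) (- q3 x)"
definition "x div y = x * inverse y" for x y :: quat

instance
proof
  fix x :: quat
  let ?c = "Quat (q0 x) (- q1 x) (- q2 x) (- q3 x)"
  let ?n = "(q0 x)\<^sup>2 + (q1 x)\<^sup>2 + (q2 x)\<^sup>2 + (q3 x)\<^sup>2"
  have *: "?c * x = ?n *\<^sub>R 1" "x * ?c = ?n *\<^sub>R 1"
    by (simp_all add: quat_eq_iff power2_eq_square algebra_simps)
  assume "x \<noteq> 0"
  then have "?n \<noteq> 0"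
    by (simp add: quat_sum_squares_eq_0_iff)
  then show "inverse x * x = 1" "x * inverse x = 1"
    unfolding inverse_quat_def mult_scaleR_left mult_scaleR_right *
    by simp_all
qed (simp_all add: divide_quat_def inverse_quat_def quat_eq_iff)

end

instantiation quat :: real_inner
begin

definition "inner x y = q0 x * q0 y + q1 x * q1 y + q2 x * q2 y + q3 x * q3 y"
definition "norm x = sqrt ((q0 x)\<^sup>2 + (q1 x)\<^sup>2 + (q2 x)\<^sup>2 + (q3 x)\<^sup>2)"
definition "sgn x = x /\<^sub>R norm x" for x :: quat
definition "dist x y = norm (x - y)" for x y :: quat
definition [code del]:
  "(uniformity :: (quat \<times> quat) filter) = (INF e\<in>{0<..}. principal {(x, y). dist x y < e})"
definition [code del]:
  "open (U :: quat set) \<longleftrightarrow> (\<forall>x\<in>U. eventually (\<lambda>(x', y). x' = x \<longrightarrow> y \<in> U) uniformity)"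

instance
proof
  fix x y z :: quat and r :: real and U :: "quat set"
  show "dist x y = norm (x - y)" "sgn x = x /\<^sub>R norm x"
    "(uniformity :: (quat \<times> quat) filter) = (INF e\<in>{0<..}. principal {(x, y). dist x y < e})"
    "open U \<longleftrightarrow> (\<forall>x\<in>U. eventually (\<lambda>(x', y). x' = x \<longrightarrow> y \<in> U) uniformity)"
    by (rule dist_quat_def sgn_quat_def uniformity_quat_def open_quat_def)+
  show "inner x y = inner y x" "inner (x + y) z = inner x z + inner y z"
    "inner (r *\<^sub>R x) y = r * inner x y"
    by (simp_all add: inner_quat_def algebra_simps)
  have *: "inner x x = (q0 x)\<^sup>2 + (q1 x)\<^sup>2 + (q2 x)\<^sup>2 + (q3 x)\<^sup>2"
    by (simp add: inner_quat_def power2_eq_square)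
  show "0 \<le> inner x x" "inner x x = 0 \<longleftrightarrow> x = 0" "norm x = sqrt (inner x x)"
    unfolding * by (simp_all add: quat_sum_squares_eq_0_iff norm_quat_def)
qed

end

lemma four_squares:
  fixes a b c d e f g h :: real
  shows "(a * e - b * f - c * g - d * h)\<^sup>2 + (a * f + b * e + c * h - d * g)\<^sup>2
    + (a * g - b * h + c * e + d * f)\<^sup>2 + (a * h + b * g - c * f + d * e)\<^sup>2
    = (a\<^sup>2 + b\<^sup>2 + c\<^sup>2 + d\<^sup>2) * (e\<^sup>2 + f\<^sup>2 + g\<^sup>2 + h\<^sup>2)"
  by algebra

instance quat :: real_normed_div_algebra
proof
  fix x y :: quat
  show "norm (x * y) = norm x * norm y"
    unfolding norm_quat_def real_sqrt_mult[symmetric]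
    unfolding quat_mult_simps by (rule arg_cong[where f=sqrt]) (rule four_squares)
qed

instantiation quat :: euclidean_space
begin

definition "Basis = {Quat 1 0 0 0, Quat 0 1 0 0, Quat 0 0 1 0, Quat 0 0 0 1}"

instance
proof
  show "(Basis :: quat set) \<noteq> {}" "finite (Basis :: quat set)"
    by (simp_all add: Basis_quat_def)
  show "inner u v = (if u = v then 1 else 0)" if "u \<in> Basis" "v \<in> Basis" for u v :: quat
    using that unfolding Basis_quat_def by (elim insertE emptyE) (simp_all add: inner_quat_def)
  show "(\<forall>u\<in>Basis. inner x u = 0) \<longleftrightarrow> x = 0" for x :: quat
    by (simp add: Basis_quat_def inner_quat_def quat_eq_iff[of x])
qed

end


section \<open>Slice regular functions on the unit ball\<close>

abbreviation quat_ball :: "quat set"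
  where "quat_ball \<equiv> ball 0 1"

definition imaginary_sphere :: "quat set"
  where "imaginary_sphere = {i. q0 i = 0 \<and> norm i = 1}"

definition partial_x :: "(quat \<Rightarrow> quat) \<Rightarrow> quat \<Rightarrow> real \<Rightarrow> real \<Rightarrow> quat"
  where "partial_x f i x y = vector_derivative (\<lambda>t. f (of_real t + i * of_real y)) (at x)"

definition partial_y :: "(quat \<Rightarrow> quat) \<Rightarrow> quat \<Rightarrow> real \<Rightarrow> real \<Rightarrow> quat"
  where "partial_y f i x y = vector_derivative (\<lambda>t. f (of_real x + i * of_real t)) (at y)"

definition slice_regular :: "(quat \<Rightarrow> quat) \<Rightarrow> bool"
  where "slice_regular f \<longleftrightarrow> f differentiable_on quat_ball \<and>
    (\<forall>i\<in>imaginary_sphere. \<forall>x y. of_real x + i * of_real y \<in> quat_ball \<longrightarrow>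
      partial_x f i x y + i * partial_y f i x y = 0)"

definition partial_x0 :: "(quat \<Rightarrow> quat) \<Rightarrow> quat \<Rightarrow> quat"
  where "partial_x0 f q = vector_derivative (\<lambda>t. f (q + of_real t)) (at 0)"


section \<open>The Bloch and little Bloch spaces\<close>

definition bloch_norm :: "(quat \<Rightarrow> quat) \<Rightarrow> real"
  where "bloch_norm f =
    norm (f 0) + (SUP q\<in>quat_ball. (1 - (norm q)\<^sup>2) * norm (partial_x0 f q))"

text \<open>
  A function with domain the unit ball is represented by a function on all quaternions that is
  \<^const>\<open>undefined\<close> off the ball, so that equality in \<open>bloch_space\<close> is equality on the ball.
  Since a real supremum is unspecified on unbounded sets, finiteness of the supremum in
  \<^const>\<open>bloch_norm\<close> is expressed by \<^const>\<open>bdd_above\<close>.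
\<close>

definition bloch_space :: "(quat \<Rightarrow> quat) set"
  where "bloch_space = {f \<in> extensional quat_ball. slice_regular f \<and>
    bdd_above ((\<lambda>q. (1 - (norm q)\<^sup>2) * norm (partial_x0 f q)) ` quat_ball)}"

definition little_bloch_space :: "(quat \<Rightarrow> quat) set"
  where "little_bloch_space = {f \<in> bloch_space.
    ((\<lambda>q. (1 - (norm q)\<^sup>2) * norm (partial_x0 f q)) \<longlongrightarrow> 0) (filtercomap norm (at_left 1))}"

text \<open>
  The value \<open>0\<close> outside \<^const>\<open>bloch_space\<close> is only there because the locale
  \<^locale>\<open>Metric_space\<close> wants a nonnegative symmetric function on the whole type.
\<close>

definition bloch_dist :: "(quat \<Rightarrow> quat) \<Rightarrow> (quat \<Rightarrow> quat) \<Rightarrow> real"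
  where "bloch_dist f g =
    (if f \<in> bloch_space \<and> g \<in> bloch_space then bloch_norm (\<lambda>q. f q - g q) else 0)"

definition bloch_topology :: "(quat \<Rightarrow> quat) topology"
  where "bloch_topology = Metric_space.mtopology bloch_space bloch_dist"

definition quat_polynomials :: "(quat \<Rightarrow> quat) set"
  where "quat_polynomials =
    {restrict (\<lambda>q. \<Sum>k\<le>n. q ^ k * a k) quat_ball | (n :: nat) (a :: nat \<Rightarrow> quat). True}"


section \<open>Well-formedness of the definitions\<close>

lemma has_vector_derivative_line:
  fixes f :: "quat \<Rightarrow> quat"
  assumes "(f has_derivative D) (at (a + of_real t0 * b))"
  shows "((\<lambda>t. f (a + of_real t * b)) has_vector_derivative D b) (at t0)"
proof -
  have "((\<lambda>t. a + of_real t * b) has_vector_derivative b) (at t0)"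
    unfolding scaleR_conv_of_real[symmetric] by (auto intro!: derivative_eq_intros)
  from vector_derivative_diff_chain_within[OF this, of f D] assms show ?thesis
    by (simp add: o_def has_derivative_at_withinI)
qed

lemma of_real_commute: "of_real r * (x :: quat) = x * of_real r"
  by (simp add: quat_eq_iff)

lemma
  assumes "(f has_derivative D) (at (of_real x + i * of_real y))"
  shows partial_x_eq: "partial_x f i x y = D 1" and partial_y_eq: "partial_y f i x y = D i"
proof -
  have "((\<lambda>t. f (i * of_real y + of_real t * 1)) has_vector_derivative D 1) (at x)"
    by (rule has_vector_derivative_line) (use assms in \<open>simp add: add.commute\<close>)
  then show "partial_x f i x y = D 1"
    unfolding partial_x_def by (intro vector_derivative_at) (simp add: add.commute)
  have "((\<lambda>t. f (of_real x + of_real t * i)) has_vector_derivative D i) (at y)"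
    by (rule has_vector_derivative_line) (use assms in \<open>simp only: of_real_commute[of _ i]\<close>)
  then show "partial_y f i x y = D i"
    unfolding partial_y_def of_real_commute[of _ i] by (rule vector_derivative_at)
qed

lemma partial_x0_eq:
  assumes "(f has_derivative D) (at q)"
  shows "partial_x0 f q = D 1"
proof -
  have "((\<lambda>t. f (q + of_real t * 1)) has_vector_derivative D 1) (at 0)"
    by (rule has_vector_derivative_line) (use assms in simp)
  then show ?thesis
    unfolding partial_x0_def by (intro vector_derivative_at) simp
qed

lemma slice_regularD:
  assumes "slice_regular f" "q \<in> quat_ball"
  obtains D where "(f has_derivative D) (at q)"
    "\<And>i x y. i \<in> imaginary_sphere \<Longrightarrow> q = of_real x + i * of_real y \<Longrightarrow> D 1 + i * D i = 0"
proof -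
  from assms obtain D where D: "(f has_derivative D) (at q)"
    by (metis differentiable_on_eq_differentiable_at differentiable_def open_ball slice_regular_def)
  moreover have "D 1 + i * D i = 0" if "i \<in> imaginary_sphere" "q = of_real x + i * of_real y" for i x y
  proof -
    have "partial_x f i x y = D 1" "partial_y f i x y = D i"
      using partial_x_eq partial_y_eq D that by auto
    with assms that show ?thesis
      unfolding slice_regular_def by metis
  qed
  ultimately show ?thesis
    using that by blast
qed

lemma slice_regularI:
  assumes "\<And>q. q \<in> quat_ball \<Longrightarrow> \<exists>D. (f has_derivative D) (at q) \<and>
    (\<forall>i\<in>imaginary_sphere. \<forall>x y. q = of_real x + i * of_real y \<longrightarrow> D 1 + i * D i = 0)"
  shows "slice_regular f"
  unfolding slice_regular_def
proof (intro conjI ballI allI impI)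
  show "f differentiable_on quat_ball"
    using assms by (metis differentiable_at_imp_differentiable_on differentiable_def)
next
  fix i x y assume i: "i \<in> imaginary_sphere" and q: "of_real x + i * of_real y \<in> quat_ball"
  from assms[OF q] obtain D where
    "(f has_derivative D) (at (of_real x + i * of_real y))" "D 1 + i * D i = 0"
    using i by blast
  then show "partial_x f i x y + i * partial_y f i x y = 0"
    by (simp add: partial_x_eq partial_y_eq)
qed

lemma slice_regular_diff:
  assumes "slice_regular f" "slice_regular g"
  shows "slice_regular (\<lambda>q. f q - g q)"
proof (rule slice_regularI)
  fix q :: quat assume q: "q \<in> quat_ball"
  obtain D where D: "(f has_derivative D) (at q)"
    "\<And>i x y. i \<in> imaginary_sphere \<Longrightarrow> q = of_real x + i * of_real y \<Longrightarrow> D 1 + i * D i = 0"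
    using slice_regularD[OF assms(1) q] by metis
  obtain E where E: "(g has_derivative E) (at q)"
    "\<And>i x y. i \<in> imaginary_sphere \<Longrightarrow> q = of_real x + i * of_real y \<Longrightarrow> E 1 + i * E i = 0"
    using slice_regularD[OF assms(2) q] by metis
  have "(D 1 - E 1) + i * (D i - E i) = 0"
    if "i \<in> imaginary_sphere" "q = of_real x + i * of_real y" for i x y
  proof -
    have "(D 1 - E 1) + i * (D i - E i) = (D 1 + i * D i) - (E 1 + i * E i)"
      by (simp add: algebra_simps)
    then show ?thesis
      using D(2)[OF that] E(2)[OF that] by simp
  qed
  then show "\<exists>D. ((\<lambda>q. f q - g q) has_derivative D) (at q) \<and>
    (\<forall>i\<in>imaginary_sphere. \<forall>x y. q = of_real x + i * of_real y \<longrightarrow> D 1 + i * D i = 0)"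
    by (intro exI[of _ "\<lambda>h. D h - E h"] conjI has_derivative_diff D E) auto
qed

lemma partial_x0_diff:
  assumes "slice_regular f" "slice_regular g" "q \<in> quat_ball"
  shows "partial_x0 (\<lambda>q. f q - g q) q = partial_x0 f q - partial_x0 g q"
proof -
  obtain D E where "(f has_derivative D) (at q)" "(g has_derivative E) (at q)"
    using slice_regularD[OF assms(1,3)] slice_regularD[OF assms(2,3)] by metis
  then show ?thesis
    using partial_x0_eq has_derivative_diff by metis
qed

lemma quat_slice_decomposition:
  obtains i x y where "i \<in> imaginary_sphere" "q = of_real x + i * of_real y"
proof -
  define v where "v = q - of_real (q0 q)"
  show ?thesis
  proof (cases "v = 0")
    case True
    then show ?thesis
      using that[of "Quat 0 1 0 0" "q0 q" 0]
      by (simp add: v_def imaginary_sphere_def norm_quat_def)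
  next
    case False
    have "v /\<^sub>R norm v \<in> imaginary_sphere"
      using False by (simp add: imaginary_sphere_def v_def)
    moreover have "q = of_real (q0 q) + (v /\<^sub>R norm v) * of_real (norm v)"
    proof -
      have "(v /\<^sub>R norm v) * of_real (norm v) = v"
        using False by (simp add: quat_eq_iff)
      then show ?thesis
        by (simp add: v_def)
    qed
    ultimately show ?thesis
      using that by blast
  qed
qed

lemma slice_regular_constant:
  assumes f: "slice_regular f" and 0: "\<And>q. q \<in> quat_ball \<Longrightarrow> partial_x0 f q = 0" and q: "q \<in> quat_ball"
  shows "f q = f 0"
proof -
  obtain i x y where i: "i \<in> imaginary_sphere" and qe: "q = of_real x + i * of_real y"
    by (rule quat_slice_decomposition)
  have "((\<lambda>t. f (of_real t * q)) has_vector_derivative 0) (at t within {0..1})" if t: "t \<in> {0..1}" for t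
  proof -
    have "norm (of_real t * q) \<le> norm q"
      using t by (simp add: norm_mult mult_left_le_one_le)
    then have tq: "of_real t * q \<in> quat_ball"
      using q by simp
    obtain D where D: "(f has_derivative D) (at (of_real t * q))"
      "\<And>i x y. i \<in> imaginary_sphere \<Longrightarrow> of_real t * q = of_real x + i * of_real y \<Longrightarrow> D 1 + i * D i = 0"
      using slice_regularD[OF f tq] by metis
    have lin: "linear D"
      using D(1) has_derivative_linear by blast
    have D1: "D 1 = 0"
      using 0[OF tq] partial_x0_eq[OF D(1)] by simp
    have "of_real t * q = of_real (t * x) + i * of_real (t * y)"
      by (simp add: qe quat_eq_iff algebra_simps)
    from D(2)[OF i this] D1 i have "D i = 0"
      by (auto simp: imaginary_sphere_def)
    moreover have "q = x *\<^sub>R 1 + y *\<^sub>R i"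
      by (simp add: qe quat_eq_iff)
    ultimately have "D q = 0"
      using D1 lin by (simp add: linear_add linear_scale)
    with has_vector_derivative_line[of f D 0 t q] D(1) show ?thesis
      by (simp add: has_vector_derivative_at_within)
  qed
  then obtain c where "\<And>t. t \<in> {0..1::real} \<Longrightarrow> f (of_real t * q) = c"
    by (rule has_vector_derivative_zero_constant[OF convex_real_interval(5)]) auto
  from this[of 0] this[of 1] show ?thesis
    by simp
qed

lemma ball_weight_pos: "q \<in> quat_ball \<Longrightarrow> 0 < 1 - (norm q)\<^sup>2"
  by (simp add: power_less_one_iff abs_square_less_1)

lemma bdd_above_bloch_diff:
  assumes "f \<in> bloch_space" "g \<in> bloch_space"
  shows "bdd_above ((\<lambda>q. (1 - (norm q)\<^sup>2) * norm (partial_x0 (\<lambda>q. f q - g q) q)) ` quat_ball)"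
proof -
  have "\<exists>A. \<forall>q\<in>quat_ball. (1 - (norm q)\<^sup>2) * norm (partial_x0 f q) \<le> A"
    "\<exists>B. \<forall>q\<in>quat_ball. (1 - (norm q)\<^sup>2) * norm (partial_x0 g q) \<le> B"
    using assms by (auto simp: bloch_space_def bdd_above_def)
  then obtain A B where
    A: "\<And>q. q \<in> quat_ball \<Longrightarrow> (1 - (norm q)\<^sup>2) * norm (partial_x0 f q) \<le> A" and
    B: "\<And>q. q \<in> quat_ball \<Longrightarrow> (1 - (norm q)\<^sup>2) * norm (partial_x0 g q) \<le> B"
    by metis
  have "(1 - (norm q)\<^sup>2) * norm (partial_x0 (\<lambda>q. f q - g q) q) \<le> A + B" if "q \<in> quat_ball" for q
  proof -
    have "(1 - (norm q)\<^sup>2) * norm (partial_x0 (\<lambda>q. f q - g q) q)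
      \<le> (1 - (norm q)\<^sup>2) * (norm (partial_x0 f q) + norm (partial_x0 g q))"
      using assms that ball_weight_pos[OF that]
      by (auto simp: partial_x0_diff bloch_space_def intro!: mult_left_mono norm_triangle_ineq4)
    then show ?thesis
      using A[OF that] B[OF that] by (simp add: distrib_left)
  qed
  then show ?thesis
    by (auto intro!: bdd_aboveI)
qed

lemma bloch_norm_diff_bound:
  assumes "f \<in> bloch_space" "g \<in> bloch_space" "q \<in> quat_ball"
  shows "(1 - (norm q)\<^sup>2) * norm (partial_x0 f q - partial_x0 g q)
    \<le> (SUP q\<in>quat_ball. (1 - (norm q)\<^sup>2) * norm (partial_x0 (\<lambda>q. f q - g q) q))"
  using cSUP_upper[OF assms(3) bdd_above_bloch_diff[OF assms(1,2)]] assms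
  by (simp add: partial_x0_diff bloch_space_def)

lemma Metric_space_bloch: "Metric_space bloch_space bloch_dist"
proof
  let ?S = "\<lambda>f g. SUP q\<in>quat_ball. (1 - (norm q)\<^sup>2) * norm (partial_x0 (\<lambda>q. f q - g q) q)"
  have zero_in: "(0::quat) \<in> quat_ball"
    by simp
  have S_nonneg: "0 \<le> ?S f g" if "f \<in> bloch_space" "g \<in> bloch_space" for f g
  proof -
    have "0 \<le> (1 - (norm (0::quat))\<^sup>2) * norm (partial_x0 f 0 - partial_x0 g 0)"
      by simp
    also have "\<dots> \<le> ?S f g"
      by (rule bloch_norm_diff_bound[OF that zero_in])
    finally show ?thesis .
  qed
  show "0 \<le> bloch_dist f g" for f g
    using S_nonneg[of f g] by (auto simp: bloch_dist_def bloch_norm_def)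
  show "bloch_dist f g = bloch_dist g f" for f g
  proof (cases "f \<in> bloch_space \<and> g \<in> bloch_space")
    case True
    then have "?S f g = ?S g f"
      by (intro SUP_cong) (auto simp: partial_x0_diff bloch_space_def norm_minus_commute)
    with True show ?thesis
      by (simp add: bloch_dist_def bloch_norm_def norm_minus_commute)
  qed (auto simp: bloch_dist_def)
  fix f g assume fg: "f \<in> bloch_space" "g \<in> bloch_space"
  then have ext: "f \<in> extensional quat_ball" "g \<in> extensional quat_ball"
    and sr: "slice_regular f" "slice_regular g"
    by (auto simp: bloch_space_def)
  show "bloch_dist f g = 0 \<longleftrightarrow> f = g"
  proof
    assume "bloch_dist f g = 0"
    then have z: "f 0 - g 0 = 0" and S: "?S f g = 0"
      using S_nonneg[OF fg] fg by (auto simp: bloch_dist_def bloch_norm_def add_nonneg_eq_0_iff)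
    have "partial_x0 (\<lambda>q. f q - g q) q = 0" if q: "q \<in> quat_ball" for q
      using bloch_norm_diff_bound[OF fg q] ball_weight_pos[OF q] sr q unfolding S
      by (simp add: partial_x0_diff mult_le_0_iff)
    then have "f q - g q = f 0 - g 0" if "q \<in> quat_ball" for q
      using slice_regular_constant[OF slice_regular_diff[OF sr]] that by blast
    then show "f = g"
      using z ext by (intro extensionalityI[of f quat_ball g]) auto
  next
    assume "f = g"
    moreover have "?S g g = 0"
      by (simp add: partial_x0_eq[OF has_derivative_const])
    ultimately show "bloch_dist f g = 0"
      by (simp add: bloch_dist_def bloch_norm_def)
  qed
  fix h assume h: "h \<in> bloch_space"
  then have srh: "slice_regular h"
    by (auto simp: bloch_space_def)
  have "?S f h \<le> ?S f g + ?S g h"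
  proof (rule cSUP_least)
    show "quat_ball \<noteq> {}"
      using zero_in by blast
    fix q :: quat assume q: "q \<in> quat_ball"
    have "norm (partial_x0 f q - partial_x0 h q)
      \<le> norm (partial_x0 f q - partial_x0 g q) + norm (partial_x0 g q - partial_x0 h q)"
      using norm_triangle_ineq[of "partial_x0 f q - partial_x0 g q" "partial_x0 g q - partial_x0 h q"]
      by simp
    then have "(1 - (norm q)\<^sup>2) * norm (partial_x0 f q - partial_x0 h q)
      \<le> (1 - (norm q)\<^sup>2) * (norm (partial_x0 f q - partial_x0 g q) + norm (partial_x0 g q - partial_x0 h q))"
      using ball_weight_pos[OF q] by (intro mult_left_mono) auto
    then show "(1 - (norm q)\<^sup>2) * norm (partial_x0 (\<lambda>q. f q - h q) q) \<le> ?S f g + ?S g h"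
      using bloch_norm_diff_bound[OF fg q] bloch_norm_diff_bound[OF fg(2) h q] sr srh q
      by (simp add: partial_x0_diff distrib_left)
  qed
  moreover have "norm (f 0 - h 0) \<le> norm (f 0 - g 0) + norm (g 0 - h 0)"
    using norm_triangle_ineq[of "f 0 - g 0" "g 0 - h 0"] by simp
  ultimately show "bloch_dist f h \<le> bloch_dist f g + bloch_dist g h"
    using fg h by (simp add: bloch_dist_def bloch_norm_def)
qed

lemma topspace_bloch_topology: "topspace bloch_topology = bloch_space"
  unfolding bloch_topology_def by (rule Metric_space.topspace_mtopology[OF Metric_space_bloch])

lemma imaginary_sphere_square:
  assumes "i \<in> imaginary_sphere"
  shows "i * i = - 1"
proof -
  have "q0 i = 0" "(q1 i)\<^sup>2 + (q2 i)\<^sup>2 + (q3 i)\<^sup>2 = 1"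
    using assms by (auto simp: imaginary_sphere_def norm_quat_def)
  then show ?thesis
    by (simp add: quat_eq_iff power2_eq_square)
qed

lemma has_derivative_quat_power:
  fixes q :: quat
  shows "\<exists>D. ((\<lambda>q. q ^ k) has_derivative D) (at q) \<and> D 1 = of_nat k * q ^ (k - 1) \<and>
    (\<forall>i x y. q = of_real x + i * of_real y \<longrightarrow> D i = i * D 1)"
proof (induction k)
  case 0
  show ?case
    by (intro exI[of _ "\<lambda>h. 0"]) auto
next
  case (Suc k)
  then obtain D where D: "((\<lambda>q. q ^ k) has_derivative D) (at q)" "D 1 = of_nat k * q ^ (k - 1)"
    "\<And>i x y. q = of_real x + i * of_real y \<Longrightarrow> D i = i * D 1"
    by blast
  have "((\<lambda>q. q ^ Suc k) has_derivative (\<lambda>h. q * D h + h * q ^ k)) (at q)"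
    using has_derivative_mult[OF has_derivative_ident D(1)] by simp
  moreover have "q * D 1 + 1 * q ^ k = of_nat (Suc k) * q ^ (Suc k - 1)"
  proof -
    have "q * (of_nat k * q ^ (k - 1)) = of_nat k * q ^ k"
    proof (cases k)
      case (Suc m)
      have "q * (of_nat k * q ^ m) = of_nat k * (q * q ^ m)"
        by (metis mult.assoc mult_of_nat_commute)
      then show ?thesis
        by (simp add: Suc)
    qed simp
    then show ?thesis
      by (simp add: D(2) algebra_simps)
  qed
  moreover have "q * D i + i * q ^ k = i * (q * D 1 + 1 * q ^ k)" if "q = of_real x + i * of_real y" for i x y
  proof -
    have "q * i = i * q"
      unfolding that by (simp add: quat_eq_iff algebra_simps)
    then have "q * (i * D 1) = i * (q * D 1)"
      by (metis mult.assoc)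
    then show ?thesis
      using D(3)[OF that] by (simp add: distrib_left)
  qed
  ultimately show ?case
    by blast
qed

lemma quat_polynomials_subset_bloch_space: "quat_polynomials \<subseteq> bloch_space"
proof
  fix f assume "f \<in> quat_polynomials"
  then obtain n :: nat and a :: "nat \<Rightarrow> quat"
    where f: "f = restrict (\<lambda>q. \<Sum>k\<le>n. q ^ k * a k) quat_ball"
    by (auto simp: quat_polynomials_def)
  have *: "\<exists>D. (f has_derivative D) (at q) \<and> D 1 = (\<Sum>k\<le>n. of_nat k * q ^ (k - 1) * a k) \<and>
    (\<forall>i\<in>imaginary_sphere. \<forall>x y. q = of_real x + i * of_real y \<longrightarrow> D 1 + i * D i = 0)"
    if q: "q \<in> quat_ball" for q
  proof -
    obtain D where D: "\<And>k. ((\<lambda>q. q ^ k) has_derivative D k) (at q)"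
      "\<And>k. D k 1 = of_nat k * q ^ (k - 1)"
      "\<And>k i x y. q = of_real x + i * of_real y \<Longrightarrow> D k i = i * D k 1"
      using has_derivative_quat_power[of _ q] by metis
    define E where "E = (\<lambda>h. \<Sum>k\<le>n. D k h * a k)"
    have "((\<lambda>q. \<Sum>k\<le>n. q ^ k * a k) has_derivative E) (at q)"
      unfolding E_def by (intro has_derivative_sum has_derivative_mult_left D)
    then have "(f has_derivative E) (at q)"
      by (rule has_derivative_transform_within_open[of _ _ _ _ quat_ball]) (use q in \<open>auto simp: f\<close>)
    moreover have "E 1 + i * E i = 0" if i: "i \<in> imaginary_sphere" "q = of_real x + i * of_real y" for i x y
    proof -
      have "E i = i * E 1"
        by (simp add: E_def D(3)[OF i(2)] sum_distrib_left mult.assoc)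
      then have "i * E i = - E 1"
        using imaginary_sphere_square[OF i(1)] by (metis mult.assoc mult_minus1)
      then show ?thesis
        by simp
    qed
    ultimately show ?thesis
      using D(2) by (intro exI[of _ E]) (auto simp: E_def)
  qed
  have "slice_regular f"
    using * by (intro slice_regularI) blast
  moreover have "(1 - (norm q)\<^sup>2) * norm (partial_x0 f q) \<le> (\<Sum>k\<le>n. real k * norm (a k))"
    if q: "q \<in> quat_ball" for q
  proof -
    have "partial_x0 f q = (\<Sum>k\<le>n. of_nat k * q ^ (k - 1) * a k)"
      using *[OF q] partial_x0_eq by metis
    also have "norm \<dots> \<le> (\<Sum>k\<le>n. norm (of_nat k * q ^ (k - 1) * a k))"
      by (rule norm_sum)
    also have "\<dots> \<le> (\<Sum>k\<le>n. real k * norm (a k))"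
      using q by (intro sum_mono)
        (simp add: norm_mult norm_power mult_right_mono mult_left_le power_le_one)
    finally have "norm (partial_x0 f q) \<le> (\<Sum>k\<le>n. real k * norm (a k))" .
    moreover have "(1 - (norm q)\<^sup>2) * norm (partial_x0 f q) \<le> norm (partial_x0 f q)"
      using ball_weight_pos[OF q] by (intro mult_left_le_one_le) auto
    ultimately show ?thesis
      by linarith
  qed
  moreover have "f \<in> extensional quat_ball"
    by (simp add: f)
  ultimately show "f \<in> bloch_space"
    unfolding bloch_space_def by (intro CollectI conjI bdd_aboveI2) blast+
qed

end

theory Submission
  imports Defs "HOL-Complex_Analysis.Complex_Analysis"
begin

text \<open>
  On each slice, the functionals \<open>w \<mapsto> \<langle>w, v\<rangle> - \<i> \<langle>i w, v\<rangle>\<close> turn a slice regular function into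
  holomorphic functions of one complex variable, and they determine it. Hence \<open>f\<close> is a
  power series on every slice; since all slices share the real axis, the coefficients do not depend
  on the slice, so \<open>f q = \<Sum>k. q ^ k * a k\<close>, and \<open>\<partial>f/\<partial>x\<^sub>0\<close> is obtained termwise.
  For \<open>f\<close> in the little Bloch space, the dilations \<open>f (r q)\<close> converge to \<open>f\<close> in the Bloch norm as
  \<open>r\<close> tends to \<open>1\<close>: near the boundary both derivatives are small, and inside they
  are compared termwise using \<open>1 - r ^ k \<le> k (1 - r)\<close>. Truncating the series of a dilation costs
  arbitrarily little because it converges absolutely on the closed ball. Restricting the
  coefficients to a countable dense set gives separability.
\<close>

section \<open>Power series expansion of slice regular functions\<close>

definition slice_embed :: "quat \<Rightarrow> complex \<Rightarrow> quat"
  where "slice_embed i z = of_real (Re z) + i * of_real (Im z)"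

text \<open>Complex linear when \<open>i\<close> acts on the quaternions from the left.\<close>

definition slice_coord :: "quat \<Rightarrow> quat \<Rightarrow> quat \<Rightarrow> complex"
  where "slice_coord i v w = Complex (inner w v) (- inner (i * w) v)"

lemma slice_embed_simps [simp]:
  "slice_embed i 0 = 0" "slice_embed i 1 = 1" "slice_embed i (of_real x) = of_real x"
  by (simp_all add: slice_embed_def)

lemma bounded_linear_slice_embed: "bounded_linear (slice_embed i)"
  unfolding linear_conv_bounded_linear[symmetric]
  by (rule linearI) (simp_all add: slice_embed_def quat_eq_iff algebra_simps)

lemma bounded_linear_slice_coord: "bounded_linear (slice_coord i v)"
  unfolding linear_conv_bounded_linear[symmetric]
  by (rule linearI) (simp_all add: slice_coord_def complex_eq_iff inner_add_left distrib_left)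

lemma slice_embed_mult:
  assumes "i \<in> imaginary_sphere"
  shows "slice_embed i (z * w) = slice_embed i z * slice_embed i w"
proof -
  have "i * of_real (Im z) * (i * of_real (Im w)) = i * i * of_real (Im z * Im w)"
    by (metis mult.assoc of_real_commute of_real_mult)
  also have "\<dots> = - of_real (Im z * Im w)"
    by (simp add: imaginary_sphere_square[OF assms])
  finally show ?thesis
    unfolding slice_embed_def by (simp add: quat_eq_iff algebra_simps)
qed

lemma slice_embed_power:
  assumes "i \<in> imaginary_sphere"
  shows "slice_embed i (z ^ n) = slice_embed i z ^ n"
  by (induction n) (simp_all add: slice_embed_mult[OF assms])

lemma norm_slice_embed:
  assumes "i \<in> imaginary_sphere"
  shows "norm (slice_embed i z) = norm z"
proof -
  have "q0 i = 0" "(q1 i)\<^sup>2 + (q2 i)\<^sup>2 + (q3 i)\<^sup>2 = 1"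
    using assms by (auto simp: imaginary_sphere_def norm_quat_def)
  moreover from this have "(q1 i * Im z)\<^sup>2 + (q2 i * Im z)\<^sup>2 + (q3 i * Im z)\<^sup>2 = (Im z)\<^sup>2"
    by (simp add: power_mult_distrib flip: distrib_right)
  ultimately show ?thesis
    by (simp add: slice_embed_def norm_quat_def cmod_def add.assoc)
qed

lemma slice_coord_mult:
  assumes "i \<in> imaginary_sphere"
  shows "slice_coord i v (i * w) = \<i> * slice_coord i v w"
proof -
  have "i * (i * w) = - w"
    using imaginary_sphere_square[OF assms] by (metis mult.assoc mult_minus1)
  then show ?thesis
    by (simp add: slice_coord_def complex_eq_iff)
qed

text \<open>The real parts of the coordinates give the basis expansion of \<open>w\<close>, the
  imaginary parts give \<open>- i * (i * w)\<close>, which is \<open>w\<close> again. Running over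
  the whole real basis avoids choosing a unit orthogonal to \<open>i\<close>; the price is the
  factor 2.\<close>

lemma slice_coord_reconstruct:
  assumes "i \<in> imaginary_sphere"
  shows "(\<Sum>v\<in>Basis. slice_embed i (slice_coord i v w) * v) = 2 *\<^sub>R w"
proof -
  have "slice_embed i (slice_coord i v w) * v = inner w v *\<^sub>R v - i * (inner (i * w) v *\<^sub>R v)" for v
    by (simp add: slice_embed_def slice_coord_def quat_eq_iff algebra_simps)
  then have "(\<Sum>v\<in>Basis. slice_embed i (slice_coord i v w) * v)
    = (\<Sum>v\<in>Basis. inner w v *\<^sub>R v) - i * (\<Sum>v\<in>Basis. inner (i * w) v *\<^sub>R v)"
    by (simp add: sum_subtractf sum_distrib_left)
  also have "\<dots> = w - i * (i * w)"
    by (simp add: euclidean_representation)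
  also have "\<dots> = 2 *\<^sub>R w"
    using imaginary_sphere_square[OF assms] by (simp add: scaleR_2 flip: mult.assoc)
  finally show ?thesis .
qed

text \<open>Transfers scalar expansions in \<open>z\<close> back to quaternions. Coefficients and
  powers commute while they are complex numbers, so the power can be moved to the left before
  \<open>v\<close> is multiplied on.\<close>

lemma slice_power_series:
  assumes i: "i \<in> imaginary_sphere"
    and c: "\<And>v. v \<in> Basis \<Longrightarrow> (\<lambda>n. c v n * z ^ n) sums slice_coord i v w"
  shows "(\<lambda>n. slice_embed i z ^ n * (\<Sum>v\<in>Basis. slice_embed i (c v n) * v) /\<^sub>R 2) sums w"
proof -
  have "(\<lambda>n. slice_embed i z ^ n * (slice_embed i (c v n) * v))
    sums (slice_embed i (slice_coord i v w) * v)" if "v \<in> Basis" for v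
  proof -
    have "(\<lambda>n. slice_embed i (c v n * z ^ n) * v) sums (slice_embed i (slice_coord i v w) * v)"
      by (intro sums_mult2 bounded_linear.sums[OF bounded_linear_slice_embed] c that)
    then show ?thesis
      by (simp add: mult.commute[of "c v _"] slice_embed_mult[OF i] slice_embed_power[OF i] mult.assoc)
  qed
  then have "(\<lambda>n. \<Sum>v\<in>Basis. slice_embed i z ^ n * (slice_embed i (c v n) * v))
    sums (\<Sum>v\<in>Basis. slice_embed i (slice_coord i v w) * v)"
    by (rule sums_sum)
  then have "(\<lambda>n. slice_embed i z ^ n * (\<Sum>v\<in>Basis. slice_embed i (c v n) * v)) sums (2 *\<^sub>R w)"
    by (simp add: sum_distrib_left slice_coord_reconstruct[OF i])
  from sums_scaleR_right[OF this, of "1/2"] show ?thesis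
    by simp
qed

section \<open>Taylor expansion on a single slice\<close>

lemma slice_coord_has_field_derivative:
  assumes f: "slice_regular f" and i: "i \<in> imaginary_sphere" and z: "norm z < 1"
  shows "((\<lambda>z. slice_coord i v (f (slice_embed i z))) has_field_derivative
    slice_coord i v (partial_x0 f (slice_embed i z))) (at z)"
proof -
  have "slice_embed i z \<in> quat_ball"
    using z by (simp add: norm_slice_embed[OF i])
  then obtain D where D: "(f has_derivative D) (at (slice_embed i z))"
    "\<And>i' x y. i' \<in> imaginary_sphere \<Longrightarrow> slice_embed i z = of_real x + i' * of_real y \<Longrightarrow> D 1 + i' * D i' = 0"
    using slice_regularD[OF f] by metis
  have lin: "linear D"
    using D(1) has_derivative_linear by blast
  have "D 1 + i * D i = 0"
    using D(2)[OF i] by (simp add: slice_embed_def)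
  \<comment> \<open>Multiplying the Cauchy-Riemann equation by \<open>i\<close> yields
    \<open>D i = i * D 1\<close>, so along the slice \<open>D\<close> is complex linear for the left
    action of \<open>i\<close>; \<open>slice_coord\<close> turns this action into complex
    multiplication.\<close>
  then have "i * (D 1 + i * D i) = 0"
    by simp
  then have Di: "D i = i * D 1"
    using imaginary_sphere_square[OF i] by (simp add: distrib_left flip: mult.assoc)
  have "slice_coord i v (D (slice_embed i h)) = slice_coord i v (D 1) * h" for h
  proof -
    have "slice_embed i h = Re h *\<^sub>R 1 + Im h *\<^sub>R i"
      by (simp add: slice_embed_def quat_eq_iff)
    then have "D (slice_embed i h) = Re h *\<^sub>R D 1 + Im h *\<^sub>R (i * D 1)"
      using lin by (simp add: linear_add linear_scale Di)
    then have "slice_coord i v (D (slice_embed i h))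
      = Re h *\<^sub>R slice_coord i v (D 1) + Im h *\<^sub>R (\<i> * slice_coord i v (D 1))"
      using bounded_linear.linear[OF bounded_linear_slice_coord, of i v]
      by (simp only: linear_add linear_scale slice_coord_mult[OF i])
    then show ?thesis
      by (simp add: complex_eq_iff algebra_simps)
  qed
  moreover have "((\<lambda>z. slice_coord i v (f (slice_embed i z))) has_derivative
    (\<lambda>h. slice_coord i v (D (slice_embed i h)))) (at z)"
    by (intro bounded_linear.has_derivative[OF bounded_linear_slice_coord]
        has_derivative_compose[OF bounded_linear_imp_has_derivative[OF bounded_linear_slice_embed]] D(1))
  ultimately show ?thesis
    by (simp add: has_field_derivative_def partial_x0_eq[OF D(1)])
qed

lemma slice_regular_power_series_on_slice:
  assumes f: "slice_regular f" and i: "i \<in> imaginary_sphere"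
  obtains a where "\<And>z. norm z < 1 \<Longrightarrow> (\<lambda>n. slice_embed i z ^ n * a n) sums f (slice_embed i z)"
    "\<And>z. norm z < 1 \<Longrightarrow> (\<lambda>n. slice_embed i z ^ n * (real (Suc n) *\<^sub>R a (Suc n)))
       sums partial_x0 f (slice_embed i z)"
proof -
  define F where "F = (\<lambda>v z. slice_coord i v (f (slice_embed i z)))"
  define c where "c = (\<lambda>v n. (deriv ^^ n) (F v) 0 / fact n)"
  define a where "a = (\<lambda>n. (\<Sum>v\<in>Basis. slice_embed i (c v n) * v) /\<^sub>R 2)"
  have F': "(F v has_field_derivative slice_coord i v (partial_x0 f (slice_embed i z))) (at z)"
    if "norm z < 1" for v z
    unfolding F_def by (rule slice_coord_has_field_derivative[OF f i that])
  have hol: "F v holomorphic_on ball 0 1" for v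
    unfolding holomorphic_on_open[OF open_ball] using F' by (metis mem_ball_0)
  have "(\<lambda>n. slice_embed i z ^ n * a n) sums f (slice_embed i z)" if z: "norm z < 1" for z
  proof -
    have "(\<lambda>n. c v n * z ^ n) sums slice_coord i v (f (slice_embed i z))" for v
      using holomorphic_power_series[OF hol, of z v] z by (simp add: c_def F_def)
    from slice_power_series[OF i this] show ?thesis
      by (simp add: a_def)
  qed
  moreover have "(\<lambda>n. slice_embed i z ^ n * (real (Suc n) *\<^sub>R a (Suc n)))
    sums partial_x0 f (slice_embed i z)" if z: "norm z < 1" for z
  proof -
    have "(\<lambda>n. (real (Suc n) *\<^sub>R c v (Suc n)) * z ^ n) sums slice_coord i v (partial_x0 f (slice_embed i z))" for v
    proof -
      \<comment> \<open>This is the Taylor series of the holomorphic function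
        \<open>deriv (F v)\<close> itself, so no termwise differentiation has to be justified. Its
        coefficients are those of \<open>F v\<close> shifted by one and multiplied by
        \<open>Suc n\<close>.\<close>
      have "(\<lambda>n. (deriv ^^ n) (deriv (F v)) 0 / fact n * (z - 0) ^ n) sums deriv (F v) z"
        by (rule holomorphic_power_series[where r=1]) (use z in \<open>auto intro: holomorphic_deriv hol\<close>)
      moreover have "deriv (F v) z = slice_coord i v (partial_x0 f (slice_embed i z))"
        using F'[OF z] by (rule DERIV_imp_deriv)
      moreover have "(deriv ^^ n) (deriv (F v)) 0 / fact n = real (Suc n) *\<^sub>R c v (Suc n)" for n
      proof -
        have "(fact (Suc n) :: complex) = of_nat (Suc n) * fact n"
          by (rule fact_Suc)
        then show ?thesis
          unfolding c_def by (simp only: funpow_Suc_right o_apply scaleR_conv_of_real)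
            (simp del: of_nat_Suc)
      qed
      ultimately show ?thesis
        by simp
    qed
    from slice_power_series[OF i this] show ?thesis
      by (simp add: a_def linear_scale[OF bounded_linear.linear[OF bounded_linear_slice_embed]]
          scaleR_left_commute flip: scaleR_sum_right)
  qed
  ultimately show ?thesis
    using that by blast
qed

section \<open>Uniqueness of coefficients and independence of the slice\<close>

lemma real_power_series_unique:
  fixes a b :: "nat \<Rightarrow> real"
  assumes "\<And>x. \<bar>x\<bar> < 1 \<Longrightarrow> (\<lambda>n. x ^ n * a n) sums g x"
    and "\<And>x. \<bar>x\<bar> < 1 \<Longrightarrow> (\<lambda>n. x ^ n * b n) sums g x"
  shows "a = b"
proof -
  have s: "(\<lambda>n. (a n - b n) * x ^ n) sums 0" if "\<bar>x\<bar> < 1" for x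
    using sums_diff[OF assms(1)[OF that] assms(2)[OF that]] by (simp add: algebra_simps)
  have "a n - b n = 0" for n
  proof (cases "n = 0")
    case True
    have "(\<lambda>n. (a n - b n) * 0 ^ n) sums (a 0 - b 0)"
      by (rule powser_sums_zero)
    then show ?thesis
      using sums_unique2[OF s[of 0]] True by simp
  next
    case False
    show ?thesis
    proof (rule ccontr)
      assume "a n - b n \<noteq> 0"
      \<comment> \<open>A power series that vanishes at its centre and has a nonzero coefficient of
        positive index has no other zero nearby, but here the sum is 0 throughout. Index 0 was
        settled by evaluation at 0.\<close>
      then obtain t :: real where t: "0 < t" "\<And>z::real. z \<in> cball 0 t - {0} \<Longrightarrow> (0::real) \<noteq> 0"
        using powser_0_nonzero[of 1 0 "\<lambda>n. a n - b n" "\<lambda>_. 0" n] s False by auto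
      from t(2)[of t] t(1) show False
        by simp
    qed
  qed
  then show ?thesis
    by auto
qed

text \<open>Powers of real numbers act as real scalars, so every coordinate is a real power
  series.\<close>

lemma quat_power_series_unique:
  fixes a b :: "nat \<Rightarrow> quat"
  assumes "\<And>x. \<bar>x\<bar> < 1 \<Longrightarrow> (\<lambda>n. of_real x ^ n * a n) sums g x"
    and "\<And>x. \<bar>x\<bar> < 1 \<Longrightarrow> (\<lambda>n. of_real x ^ n * b n) sums g x"
  shows "a = b"
proof
  fix n
  show "a n = b n"
  proof (rule euclidean_eqI)
    fix v :: quat
    have *: "(\<lambda>n. x ^ n * inner (c n) v) sums inner (g x) v"
      if "(\<lambda>n. of_real x ^ n * c n) sums g x" for x c
    proof -
      have "of_real x ^ n * c n = x ^ n *\<^sub>R c n" for n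
        by (simp add: scaleR_conv_of_real)
      then show ?thesis
        using bounded_linear.sums[OF bounded_linear_inner_left that, of v] by simp
    qed
    have "(\<lambda>n. inner (a n) v) = (\<lambda>n. inner (b n) v)"
      by (rule real_power_series_unique[of _ "\<lambda>x. inner (g x) v"]) (auto intro: * assms)
    then show "inner (a n) v = inner (b n) v"
      by metis
  qed
qed

lemma slice_regular_power_series:
  assumes f: "slice_regular f"
  obtains a where "\<And>q. q \<in> quat_ball \<Longrightarrow> (\<lambda>n. q ^ n * a n) sums f q"
    "\<And>q. q \<in> quat_ball \<Longrightarrow> (\<lambda>n. real n *\<^sub>R (q ^ (n - 1) * a n)) sums partial_x0 f q"
proof -
  have "\<exists>a. \<forall>i\<in>imaginary_sphere.
    (\<forall>z. norm z < 1 \<longrightarrow> (\<lambda>n. slice_embed i z ^ n * a i n) sums f (slice_embed i z)) \<and>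
    (\<forall>z. norm z < 1 \<longrightarrow> (\<lambda>n. slice_embed i z ^ n * (real (Suc n) *\<^sub>R a i (Suc n)))
       sums partial_x0 f (slice_embed i z))"
    by (rule bchoice) (metis slice_regular_power_series_on_slice[OF f])
  then obtain a where
    a: "\<And>i z. i \<in> imaginary_sphere \<Longrightarrow> norm z < 1 \<Longrightarrow>
      (\<lambda>n. slice_embed i z ^ n * a i n) sums f (slice_embed i z)" and
    a': "\<And>i z. i \<in> imaginary_sphere \<Longrightarrow> norm z < 1 \<Longrightarrow>
      (\<lambda>n. slice_embed i z ^ n * (real (Suc n) *\<^sub>R a i (Suc n))) sums partial_x0 f (slice_embed i z)"
    by metis
  have real: "(\<lambda>n. of_real x ^ n * a i n) sums f (of_real x)" if "i \<in> imaginary_sphere" "\<bar>x\<bar> < 1" for i x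
    using a[of i "of_real x"] that by simp
  define i0 where "i0 = Quat 0 1 0 0"
  have i0: "i0 \<in> imaginary_sphere"
    by (simp add: i0_def imaginary_sphere_def norm_quat_def)
  have indep: "a i = a i0" if "i \<in> imaginary_sphere" for i
    by (rule quat_power_series_unique[OF real[OF that] real[OF i0]])
  have "(\<lambda>n. q ^ n * a i0 n) sums f q \<and> (\<lambda>n. real n *\<^sub>R (q ^ (n - 1) * a i0 n)) sums partial_x0 f q"
    if q: "q \<in> quat_ball" for q
  proof -
    obtain i x y where i: "i \<in> imaginary_sphere" "q = of_real x + i * of_real y"
      by (rule quat_slice_decomposition)
    then have e: "q = slice_embed i (Complex x y)"
      by (simp add: slice_embed_def)
    then have n: "norm (Complex x y) < 1"
      using q norm_slice_embed[OF i(1)] by simp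
    have "(\<lambda>n. real (Suc n) *\<^sub>R (q ^ (Suc n - 1) * a i0 (Suc n))) sums partial_x0 f q"
      using a'[OF i(1) n] by (simp add: indep[OF i(1)] flip: e)
    \<comment> \<open>The added term of index 0 vanishes through its factor \<open>real 0\<close>,
      although \<open>q ^ (0 - 1)\<close> is 1.\<close>
    then have "(\<lambda>n. real n *\<^sub>R (q ^ (n - 1) * a i0 n)) sums partial_x0 f q"
      by (subst (asm) sums_Suc_iff) simp
    then show ?thesis
      using a[OF i(1) n] by (simp add: indep[OF i(1)] flip: e)
  qed
  then show ?thesis
    using that by blast
qed

section \<open>Absolute convergence of the coefficient series\<close>

lemma summable_norm_coeff:
  fixes a :: "nat \<Rightarrow> quat"
  assumes "\<And>q. q \<in> quat_ball \<Longrightarrow> summable (\<lambda>n. q ^ n * a n)" and x: "\<bar>x\<bar> < 1"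
  shows "summable (\<lambda>n. norm (a n) * x ^ n)"
proof -
  \<comment> \<open>Convergence at a real radius strictly between \<open>\<bar>x\<bar>\<close> and 1
    forces absolute convergence at \<open>x\<close>.\<close>
  define t where "t = (1 + \<bar>x\<bar>) / 2"
  have t: "\<bar>x\<bar> < t" "t < 1" "0 < t"
    using x by (auto simp: t_def)
  have "of_real t ^ n * a n = a n * of_real t ^ n" for n
    by (metis of_real_commute of_real_power)
  moreover have "summable (\<lambda>n. of_real t ^ n * a n)"
    by (rule assms) (use t in simp)
  ultimately have "summable (\<lambda>n. a n * of_real t ^ n)"
    by simp
  then have "summable (\<lambda>n. norm (a n * of_real x ^ n))"
    by (rule powser_insidea) (use t in simp)
  then have "summable (\<lambda>n. norm (norm (a n) * x ^ n))"
    by (simp add: norm_mult norm_power abs_mult power_abs)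
  then show ?thesis
    by (rule summable_norm_cancel)
qed

text \<open>Up to a shift and a factor \<open>x\<close> this is the derived series, which converges
  in the same disc. Two applications give the factor \<open>(real n)\<^sup>2\<close> that the
  dilation estimate needs.\<close>

lemma summable_index_mult:
  fixes c :: "nat \<Rightarrow> real"
  assumes "\<And>x. \<bar>x\<bar> < 1 \<Longrightarrow> summable (\<lambda>n. c n * x ^ n)" "\<bar>x\<bar> < 1"
  shows "summable (\<lambda>n. real n * c n * x ^ n)"
proof -
  have "summable (\<lambda>n. diffs c n * x ^ n)"
    by (rule termdiff_converges[where K=1]) (use assms in auto)
  from summable_mult[OF this, of x] have "summable (\<lambda>n. real (Suc n) * c (Suc n) * x ^ Suc n)"
    by (simp add: diffs_def algebra_simps)
  then show ?thesis
    by (subst (asm) summable_Suc_iff)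
qed

section \<open>Approximation by polynomials\<close>

definition quat_poly :: "nat \<Rightarrow> (nat \<Rightarrow> quat) \<Rightarrow> quat \<Rightarrow> quat"
  where "quat_poly n a = restrict (\<lambda>q. \<Sum>k\<le>n. q ^ k * a k) quat_ball"

lemma quat_polynomials_eq: "quat_polynomials = {quat_poly n a | n a. True}"
  by (simp add: quat_polynomials_def quat_poly_def)

lemma quat_poly_in_bloch_space: "quat_poly n a \<in> bloch_space"
  using quat_polynomials_subset_bloch_space by (auto simp: quat_polynomials_eq)

lemma quat_poly_0: "quat_poly n a 0 = a 0"
proof -
  have "(\<Sum>k\<le>n. 0 ^ k * a k) = (\<Sum>k\<le>n. if k = 0 then a 0 else 0)"
    by (intro sum.cong) (auto simp: power_0_left)
  then show ?thesis
    by (simp add: quat_poly_def)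
qed

lemma partial_x0_quat_poly:
  assumes q: "q \<in> quat_ball"
  shows "partial_x0 (quat_poly n a) q = (\<Sum>k\<le>n. real k *\<^sub>R (q ^ (k - 1) * a k))"
proof -
  obtain D where D: "\<And>k. ((\<lambda>q. q ^ k) has_derivative D k) (at q)"
    "\<And>k. D k 1 = of_nat k * q ^ (k - 1)"
    using has_derivative_quat_power[of _ q] by metis
  have "((\<lambda>q. \<Sum>k\<le>n. q ^ k * a k) has_derivative (\<lambda>h. \<Sum>k\<le>n. D k h * a k)) (at q)"
    by (intro has_derivative_sum has_derivative_mult_left D)
  then have "(quat_poly n a has_derivative (\<lambda>h. \<Sum>k\<le>n. D k h * a k)) (at q)"
    by (rule has_derivative_transform_within_open[of _ _ _ _ quat_ball])
      (use q in \<open>auto simp: quat_poly_def\<close>)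
  then show ?thesis
    by (simp add: partial_x0_eq D(2) scaleR_conv_of_real mult.assoc)
qed

lemma norm_partial_x0_quat_poly_le:
  assumes "q \<in> quat_ball"
  shows "norm (partial_x0 (quat_poly n a) q) \<le> (\<Sum>k\<le>n. real k * norm (a k))"
  unfolding partial_x0_quat_poly[OF assms] using assms
  by (intro sum_norm_le) (simp add: norm_mult norm_power mult_left_le_one_le power_le_one mult_left_mono)

text \<open>Together with \<open>bloch_dist_bound\<close>, this replaces the supremum in the Bloch
  distance by pointwise estimates.\<close>

lemma bloch_dist_le:
  assumes "f \<in> bloch_space" "g \<in> bloch_space"
    and "\<And>q. q \<in> quat_ball \<Longrightarrow> (1 - (norm q)\<^sup>2) * norm (partial_x0 f q - partial_x0 g q) \<le> c"
  shows "bloch_dist f g \<le> norm (f 0 - g 0) + c"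
proof -
  have "(SUP q\<in>quat_ball. (1 - (norm q)\<^sup>2) * norm (partial_x0 (\<lambda>q. f q - g q) q)) \<le> c"
    by (rule cSUP_least) (use assms in \<open>auto simp: partial_x0_diff bloch_space_def\<close>)
  then show ?thesis
    using assms by (simp add: bloch_dist_def bloch_norm_def)
qed

lemma bloch_dist_bound:
  assumes "f \<in> bloch_space" "g \<in> bloch_space" "q \<in> quat_ball"
  shows "(1 - (norm q)\<^sup>2) * norm (partial_x0 f q - partial_x0 g q) \<le> bloch_dist f g"
  using bloch_norm_diff_bound[OF assms] norm_ge_zero[of "f 0 - g 0"] assms(1,2)
  unfolding bloch_dist_def bloch_norm_def by (simp del: norm_ge_zero)

section \<open>The little Bloch space as a closed set containing the polynomials\<close>

lemma little_bloch_space_iff: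
  "f \<in> little_bloch_space \<longleftrightarrow> f \<in> bloch_space \<and>
    (\<forall>e>0. \<exists>b<1. \<forall>q. b < norm q \<and> norm q < 1 \<longrightarrow> (1 - (norm q)\<^sup>2) * norm (partial_x0 f q) < e)"
proof -
  \<comment> \<open>The shells \<open>b < norm q < 1\<close> form a base of this filter, so the
    limit sees only points of the ball; \<open>b\<close> may be negative.\<close>
  have ev: "eventually P (filtercomap norm (at_left 1)) \<longleftrightarrow> (\<exists>b<1. \<forall>q. b < norm q \<and> norm q < 1 \<longrightarrow> P q)"
    for P :: "quat \<Rightarrow> bool"
  proof
    assume "eventually P (filtercomap norm (at_left 1))"
    then obtain Q where "eventually Q (at_left (1::real))" "\<And>q. Q (norm q) \<Longrightarrow> P q"
      by (auto simp: eventually_filtercomap)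
    then show "\<exists>b<1. \<forall>q. b < norm q \<and> norm q < 1 \<longrightarrow> P q"
      unfolding eventually_at_left_field by metis
  next
    assume "\<exists>b<1. \<forall>q. b < norm q \<and> norm q < 1 \<longrightarrow> P q"
    then obtain b where b: "b < 1" "\<And>q. b < norm q \<Longrightarrow> norm q < 1 \<Longrightarrow> P q"
      by blast
    then have "eventually (\<lambda>x. b < x \<and> x < 1) (at_left (1::real))"
      unfolding eventually_at_left_field by blast
    with b show "eventually P (filtercomap norm (at_left 1))"
      unfolding eventually_filtercomap by blast
  qed
  have abs: "\<bar>1 - (norm q)\<^sup>2\<bar> = 1 - (norm q)\<^sup>2" if "norm q < 1" for q :: quat
    using ball_weight_pos[of q] that by simp
  show ?thesis
    unfolding little_bloch_space_def tendsto_iff ev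
    by (auto simp: abs_mult abs cong: conj_cong imp_cong)
qed

text \<open>The derivative of a polynomial is bounded on the ball, while the weight tends to 0 at
  the boundary.\<close>

lemma quat_polynomials_subset_little_bloch_space: "quat_polynomials \<subseteq> little_bloch_space"
proof
  fix f assume "f \<in> quat_polynomials"
  then obtain n a where f: "f = quat_poly n a"
    by (auto simp: quat_polynomials_eq)
  \<comment> \<open>The summand 1 keeps \<open>M\<close> positive for constant polynomials.\<close>
  define M where "M = (\<Sum>k\<le>n. real k * norm (a k)) + 1"
  have M: "0 < M"
    by (simp add: M_def add_nonneg_pos sum_nonneg)
  have "\<exists>b<1. \<forall>q. b < norm q \<and> norm q < 1 \<longrightarrow> (1 - (norm q)\<^sup>2) * norm (partial_x0 f q) < e" if e: "e > 0" for e
  proof (intro exI conjI allI impI)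
    \<comment> \<open>Beyond this radius the weight is at most \<open>2 * (1 - norm q)\<close>,
      hence below \<open>e / M\<close>.\<close>
    let ?b = "1 - e / (2 * M)"
    show "?b < 1"
      using e M by simp
    fix q :: quat assume q: "?b < norm q \<and> norm q < 1"
    then have "1 - (norm q)\<^sup>2 = (1 - norm q) * (1 + norm q)"
      by (simp add: power2_eq_square algebra_simps)
    also have "\<dots> \<le> (1 - norm q) * 2"
      using q by (intro mult_left_mono) auto
    finally have w: "1 - (norm q)\<^sup>2 < e / M"
      using q by (simp add: field_simps)
    have "norm (partial_x0 f q) \<le> M"
      using norm_partial_x0_quat_poly_le[of q n a] q by (simp add: f M_def)
    moreover have "0 < 1 - (norm q)\<^sup>2"
      using q by (intro ball_weight_pos) simp
    ultimately have "(1 - (norm q)\<^sup>2) * norm (partial_x0 f q) \<le> (1 - (norm q)\<^sup>2) * M"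
      by (intro mult_left_mono) auto
    also have "\<dots> < e"
      using w M by (simp add: field_simps)
    finally show "(1 - (norm q)\<^sup>2) * norm (partial_x0 f q) < e" .
  qed
  then show "f \<in> little_bloch_space"
    by (simp add: little_bloch_space_iff f quat_poly_in_bloch_space)
qed

lemma bloch_closure_iff:
  "f \<in> bloch_topology closure_of S \<longleftrightarrow>
    f \<in> bloch_space \<and> (\<forall>e>0. \<exists>g\<in>S \<inter> bloch_space. bloch_dist f g < e)"
  unfolding bloch_topology_def Metric_space.metric_closure_of[OF Metric_space_bloch]
  by (auto simp: Metric_space.in_mball[OF Metric_space_bloch])

text \<open>If \<open>g\<close> is within \<open>e / 2\<close> of \<open>f\<close>, a shell on which
  the weighted derivative of \<open>g\<close> stays below \<open>e / 2\<close> serves for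
  \<open>f\<close> with bound \<open>e\<close>.\<close>

lemma closure_of_little_bloch_space: "bloch_topology closure_of little_bloch_space = little_bloch_space"
proof
  show "bloch_topology closure_of little_bloch_space \<subseteq> little_bloch_space"
  proof
    fix f assume "f \<in> bloch_topology closure_of little_bloch_space"
    then have f: "f \<in> bloch_space"
      "\<And>e. e > 0 \<Longrightarrow> \<exists>g\<in>little_bloch_space \<inter> bloch_space. bloch_dist f g < e"
      by (auto simp: bloch_closure_iff)
    have "\<exists>b<1. \<forall>q. b < norm q \<and> norm q < 1 \<longrightarrow> (1 - (norm q)\<^sup>2) * norm (partial_x0 f q) < e"
      if "e > 0" for e
    proof -
      obtain g where g: "g \<in> little_bloch_space" "g \<in> bloch_space" "bloch_dist f g < e / 2"
        using f(2)[of "e / 2"] \<open>e > 0\<close> by auto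
      obtain b where b: "b < 1" "\<And>q. b < norm q \<Longrightarrow> norm q < 1 \<Longrightarrow>
          (1 - (norm q)\<^sup>2) * norm (partial_x0 g q) < e / 2"
        using g(1) \<open>e > 0\<close> unfolding little_bloch_space_iff by (metis half_gt_zero)
      have "(1 - (norm q)\<^sup>2) * norm (partial_x0 f q) < e" if q: "b < norm q" "norm q < 1" for q
      proof -
        have "norm (partial_x0 f q) \<le> norm (partial_x0 f q - partial_x0 g q) + norm (partial_x0 g q)"
          using norm_triangle_ineq[of "partial_x0 f q - partial_x0 g q" "partial_x0 g q"] by simp
        then have "(1 - (norm q)\<^sup>2) * norm (partial_x0 f q)
          \<le> (1 - (norm q)\<^sup>2) * (norm (partial_x0 f q - partial_x0 g q) + norm (partial_x0 g q))"
          using ball_weight_pos[of q] q by (intro mult_left_mono) auto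
        then show ?thesis
          using bloch_dist_bound[OF f(1) g(2), of q] g(3) b(2)[OF q] q by (simp add: distrib_left)
      qed
      then show ?thesis
        using b(1) by blast
    qed
    then show "f \<in> little_bloch_space"
      using f(1) by (simp add: little_bloch_space_iff)
  qed
  show "little_bloch_space \<subseteq> bloch_topology closure_of little_bloch_space"
    by (rule closure_of_subset) (auto simp: topspace_bloch_topology little_bloch_space_def)
qed

section \<open>Approximation by truncated dilations\<close>

lemma little_bloch_space_approx:
  assumes f: "f \<in> little_bloch_space" and e: "e > 0"
  obtains N c where "bloch_dist f (quat_poly N c) \<le> 3 * e"
proof -
  have fb: "f \<in> bloch_space" and sr: "slice_regular f"
    using f by (auto simp: little_bloch_space_def bloch_space_def)
  obtain a where a: "\<And>q. q \<in> quat_ball \<Longrightarrow> (\<lambda>n. q ^ n * a n) sums f q"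
    and a': "\<And>q. q \<in> quat_ball \<Longrightarrow> (\<lambda>n. real n *\<^sub>R (q ^ (n - 1) * a n)) sums partial_x0 f q"
    using slice_regular_power_series[OF sr] by blast
  obtain b0 where b0: "b0 < 1" "\<And>q. b0 < norm q \<Longrightarrow> norm q < 1 \<Longrightarrow>
      (1 - (norm q)\<^sup>2) * norm (partial_x0 f q) < e"
    using f e unfolding little_bloch_space_iff by metis
  \<comment> \<open>\<open>b0\<close> may be negative; a nonnegative threshold keeps the radius
    \<open>s\<close> positive.\<close>
  define b where "b = max b0 0"
  have b: "b < 1" "0 \<le> b" "\<And>q. b < norm q \<Longrightarrow> norm q < 1 \<Longrightarrow>
      (1 - (norm q)\<^sup>2) * norm (partial_x0 f q) < e"
    using b0 by (auto simp: b_def)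
  have sum0: "summable (\<lambda>n. norm (a n) * x ^ n)" if "\<bar>x\<bar> < 1" for x
    using summable_norm_coeff[OF sums_summable[OF a] that] .
  have sum1: "summable (\<lambda>n. real n * norm (a n) * x ^ n)" if "\<bar>x\<bar> < 1" for x
    by (rule summable_index_mult[OF sum0 that])
  have sum2: "summable (\<lambda>n. real n * (real n * norm (a n)) * x ^ n)" if "\<bar>x\<bar> < 1" for x
    by (rule summable_index_mult[OF sum1 that])
  \<comment> \<open>\<open>s\<close> separates the inner ball from the shell; lying strictly above
    \<open>b\<close>, it leaves room for dilated shell points to stay beyond
    \<open>b\<close>.\<close>
  define s where "s = (1 + b) / 2"
  have s: "0 < s" "s < 1" "b < s"
    using b by (auto simp: s_def)
  \<comment> \<open>Majorant for \<open>norm q \<le> s\<close>: one factor \<open>n\<close> comes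
    from the derivative, the other from \<open>1 - r ^ n \<le> n * (1 - r)\<close>.\<close>
  define u where "u = (\<lambda>n. (real n)\<^sup>2 * s ^ (n - 1) * norm (a n))"
  have "u = (\<lambda>n. real n * (real n * norm (a n)) * s ^ n / s)"
  proof
    show "u n = real n * (real n * norm (a n)) * s ^ n / s" for n
      using s by (cases n) (simp_all add: u_def power2_eq_square)
  qed
  then have u: "summable u"
    using sum2[of s] s by (simp add: summable_divide)
  define C where "C = suminf u"
  have C: "0 \<le> C"
    unfolding C_def using s by (intro suminf_nonneg u) (simp add: u_def)
  \<comment> \<open>The first entry gives \<open>b < r * s\<close> and keeps \<open>r\<close>
    positive; the second gives \<open>(1 - r) * C \<le> e\<close>, with \<open>C + 1\<close>
    guarding against \<open>C = 0\<close>.\<close>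
  define r where "r = max (s / (s + (s - b) / 2)) (1 - e / (C + 1))"
  have r: "r < 1" "0 < r" "b < r * s" "(1 - r) * C \<le> e"
  proof -
    have p: "s / (s + (s - b) / 2) < 1" "0 < s / (s + (s - b) / 2)"
      using s by (auto simp: field_simps)
    then show "r < 1" "0 < r"
      using e C by (auto simp: r_def less_max_iff_disj)
    have "b * (s + (s - b) / 2) < s * s"
    proof -
      have "s * s - b * (s + (s - b) / 2) = (s - b) * (s - b / 2)"
        by (simp add: field_simps)
      also have "\<dots> > 0"
        using s b by (intro mult_pos_pos) auto
      finally show ?thesis by simp
    qed
    then have "b < s / (s + (s - b) / 2) * s"
      using s by (simp add: field_simps)
    also have "\<dots> \<le> r * s"
      using s by (intro mult_right_mono) (auto simp: r_def)
    finally show "b < r * s" .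
    have "1 - r \<le> e / (C + 1)"
      by (simp add: r_def)
    then have "(1 - r) * C \<le> e / (C + 1) * C"
      using C by (rule mult_right_mono)
    also have "\<dots> \<le> e"
      using C e by (simp add: field_simps)
    finally show "(1 - r) * C \<le> e" .
  qed
  have tail: "summable (\<lambda>n. real n * norm (a n) * r ^ n)"
    using sum1 r by simp
  \<comment> \<open>\<open>N\<close> is chosen before \<open>q\<close>: powers of \<open>q\<close>
    have norm at most 1, so this tail bounds the truncation error on the whole ball.\<close>
  obtain N where "\<And>n. n \<ge> N \<Longrightarrow> norm (\<Sum>k. real (k + n) * norm (a (k + n)) * r ^ (k + n)) < e"
    using suminf_exist_split[OF e tail] by blast
  \<comment> \<open>The polynomial keeps the indices up to \<open>N\<close>, so the remainder starts
    at \<open>Suc N\<close>.\<close>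
  then have N: "norm (\<Sum>k. real (k + Suc N) * norm (a (k + Suc N)) * r ^ (k + Suc N)) < e"
    using le_SucI[OF order_refl] .
  let ?P = "quat_poly N (\<lambda>k. r ^ k *\<^sub>R a k)"
  \<comment> \<open>Dilation costs at most \<open>2 * e\<close> and truncation at most
    \<open>e\<close>. The origin adds nothing, because \<open>r ^ 0 = 1\<close> leaves
    \<open>a 0\<close> unchanged.\<close>
  have "(1 - (norm q)\<^sup>2) * norm (partial_x0 f q - partial_x0 ?P q) \<le> 3 * e" if q: "q \<in> quat_ball" for q
  proof -
    have nq: "norm q < 1"
      using q by simp
    have w: "0 \<le> 1 - (norm q)\<^sup>2" "1 - (norm q)\<^sup>2 \<le> 1"
      using ball_weight_pos[OF q] by simp_all
    \<comment> \<open>By the chain rule this is the derivative at \<open>q\<close> of the dilation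
      \<open>f (r q)\<close>; only this value and its series are used, not the dilated
      function.\<close>
    define d where "d = r *\<^sub>R partial_x0 f (r *\<^sub>R q)"
    have "r * norm q \<le> norm q"
      using r by (simp add: mult_left_le_one_le)
    then have rq: "r *\<^sub>R q \<in> quat_ball"
      using nq r by simp
    have d: "(\<lambda>n. real n *\<^sub>R (q ^ (n - 1) * (r ^ n *\<^sub>R a n))) sums d"
    proof -
      have "r *\<^sub>R (real n *\<^sub>R ((r *\<^sub>R q) ^ (n - 1) * a n)) = real n *\<^sub>R (q ^ (n - 1) * (r ^ n *\<^sub>R a n))" for n
        by (cases n) (simp_all add: scaleR_power mult.commute mult.left_commute)
      then show ?thesis
        using sums_scaleR_right[OF a'[OF rq], of r] by (simp only: d_def)
    qed
    have trunc: "norm (d - partial_x0 ?P q) \<le> e"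
    proof -
      have "(\<lambda>n. real (n + Suc N) *\<^sub>R (q ^ (n + Suc N - 1) * (r ^ (n + Suc N) *\<^sub>R a (n + Suc N))))
        sums (d - partial_x0 ?P q)"
        unfolding partial_x0_quat_poly[OF q] lessThan_Suc_atMost[symmetric]
        using d by (subst sums_iff_shift') simp
      from sums_unique[OF this] have "norm (d - partial_x0 ?P q)
        = norm (\<Sum>n. real (n + Suc N) *\<^sub>R (q ^ (n + Suc N - 1) * (r ^ (n + Suc N) *\<^sub>R a (n + Suc N))))"
        by (rule arg_cong)
      also have "\<dots> \<le> (\<Sum>k. real (k + Suc N) * norm (a (k + Suc N)) * r ^ (k + Suc N))"
      proof (rule norm_suminf_le)
        show "summable (\<lambda>k. real (k + Suc N) * norm (a (k + Suc N)) * r ^ (k + Suc N))"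
          by (rule summable_ignore_initial_segment[OF tail])
        have "norm (real n *\<^sub>R (q ^ (n - 1) * (r ^ n *\<^sub>R a n))) \<le> real n * norm (a n) * r ^ n" for n
        proof -
          have "norm (real n *\<^sub>R (q ^ (n - 1) * (r ^ n *\<^sub>R a n)))
            = norm q ^ (n - 1) * (real n * norm (a n) * r ^ n)"
            using r by (simp add: norm_mult norm_power)
          also have "\<dots> \<le> real n * norm (a n) * r ^ n"
            using r nq by (intro mult_left_le_one_le) (auto simp: power_le_one)
          finally show ?thesis .
        qed
        then show "norm (real (n + Suc N) *\<^sub>R (q ^ (n + Suc N - 1) * (r ^ (n + Suc N) *\<^sub>R a (n + Suc N))))
          \<le> real (n + Suc N) * norm (a (n + Suc N)) * r ^ (n + Suc N)" for n .
      qed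
      finally have "norm (d - partial_x0 ?P q)
        \<le> (\<Sum>k. real (k + Suc N) * norm (a (k + Suc N)) * r ^ (k + Suc N))" .
      then show ?thesis
        using N by simp
    qed
    have "(1 - (norm q)\<^sup>2) * norm (partial_x0 f q - d) \<le> 2 * e"
    proof (cases "norm q \<le> s")
      case True
      have "norm (real n *\<^sub>R (q ^ (n - 1) * a n) - real n *\<^sub>R (q ^ (n - 1) * (r ^ n *\<^sub>R a n)))
        \<le> (1 - r) * u n" for n
      proof -
        have "real n *\<^sub>R (q ^ (n - 1) * a n) - real n *\<^sub>R (q ^ (n - 1) * (r ^ n *\<^sub>R a n))
          = (real n * (1 - r ^ n)) *\<^sub>R (q ^ (n - 1) * a n)"
          by (simp add: algebra_simps)
        also have "norm \<dots> = real n * (1 - r ^ n) * (norm q ^ (n - 1) * norm (a n))"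
          using r by (simp add: norm_mult norm_power power_le_one)
        also have "\<dots> \<le> real n * (real n * (1 - r)) * (s ^ (n - 1) * norm (a n))"
        proof (intro mult_mono mult_nonneg_nonneg power_mono)
          have "1 + real n * (r - 1) \<le> (1 + (r - 1)) ^ n"
            using r by (intro Bernoulli_inequality) simp
          then show "1 - r ^ n \<le> real n * (1 - r)"
            by (simp add: algebra_simps)
        qed (use r s True in \<open>auto simp: power_le_one\<close>)
        finally show ?thesis
          by (simp add: u_def power2_eq_square algebra_simps)
      qed
      from norm_suminf_le[OF this summable_mult[OF u]]
      have "norm (\<Sum>n. real n *\<^sub>R (q ^ (n - 1) * a n) - real n *\<^sub>R (q ^ (n - 1) * (r ^ n *\<^sub>R a n)))
        \<le> (1 - r) * C"
        by (simp only: C_def suminf_mult[OF u])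
      then have "norm (partial_x0 f q - d) \<le> (1 - r) * C"
        by (simp only: sums_unique[OF sums_diff[OF a'[OF q] d], symmetric])
      then have "norm (partial_x0 f q - d) \<le> e"
        using r by simp
      then show ?thesis
        using mult_left_le_one_le[OF norm_ge_zero w, of "partial_x0 f q - d"] e by simp
    next
      case False
      \<comment> \<open>Both \<open>q\<close> and \<open>r *\<^sub>R q\<close> lie beyond
        \<open>b\<close>, so the boundary estimate applies at both points.\<close>
      have "r * s \<le> r * norm q"
        using False r by simp
      then have "b < r * norm q"
        using r(3) by linarith
      then have "b < norm (r *\<^sub>R q)" "b < norm q"
        using r(2) s False by auto
      then have 1: "(1 - (norm q)\<^sup>2) * norm (partial_x0 f q) \<le> e"
        and 2: "(1 - (norm (r *\<^sub>R q))\<^sup>2) * norm (partial_x0 f (r *\<^sub>R q)) \<le> e"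
        using b(3)[of q] b(3)[of "r *\<^sub>R q"] nq rq by (auto intro: less_imp_le)
      have "norm (r *\<^sub>R q) \<le> norm q"
        using r by (simp add: mult_left_le_one_le)
      then have "(norm (r *\<^sub>R q))\<^sup>2 \<le> (norm q)\<^sup>2"
        by (intro power_mono) auto
      moreover have "norm d \<le> norm (partial_x0 f (r *\<^sub>R q))"
        using r by (simp add: d_def mult_left_le_one_le)
      \<comment> \<open>The weight decreases with the norm, so the bound at
        \<open>r *\<^sub>R q\<close> carries over to \<open>d\<close> weighted at
        \<open>q\<close>.\<close>
      ultimately have "(1 - (norm q)\<^sup>2) * norm d
        \<le> (1 - (norm (r *\<^sub>R q))\<^sup>2) * norm (partial_x0 f (r *\<^sub>R q))"
        using w ball_weight_pos[OF rq] by (intro mult_mono) (auto simp del: norm_scaleR)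
      moreover have "(1 - (norm q)\<^sup>2) * norm (partial_x0 f q - d)
        \<le> (1 - (norm q)\<^sup>2) * (norm (partial_x0 f q) + norm d)"
        using w by (intro mult_left_mono norm_triangle_ineq4) auto
      ultimately show ?thesis
        using 1 2 by (simp add: distrib_left)
    qed
    moreover have "(1 - (norm q)\<^sup>2) * norm (d - partial_x0 ?P q) \<le> e"
      using mult_left_le_one_le[OF norm_ge_zero w, of "d - partial_x0 ?P q"] trunc by simp
    moreover have "(1 - (norm q)\<^sup>2) * norm (partial_x0 f q - partial_x0 ?P q)
      \<le> (1 - (norm q)\<^sup>2) * (norm (partial_x0 f q - d) + norm (d - partial_x0 ?P q))"
      using norm_triangle_ineq[of "partial_x0 f q - d" "d - partial_x0 ?P q"] w
      by (intro mult_left_mono) auto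
    ultimately show ?thesis
      by (simp add: distrib_left)
  qed
  then have "bloch_dist f ?P \<le> norm (f 0 - ?P 0) + 3 * e"
    by (intro bloch_dist_le fb quat_poly_in_bloch_space)
  moreover have "f 0 = a 0"
  proof -
    have "(\<lambda>n. 0 ^ n * a n) = (\<lambda>n. if n = 0 then a n else 0)"
      by (auto simp: power_0_left)
    moreover have "(\<lambda>n. if n = 0 then a n else 0) sums a 0"
      by (rule sums_single)
    moreover have "(\<lambda>n. 0 ^ n * a n) sums f 0"
      by (rule a) simp
    ultimately show ?thesis
      using sums_unique2 by metis
  qed
  ultimately show ?thesis
    using that by (simp add: quat_poly_0)
qed

lemma closure_of_quat_polynomials: "bloch_topology closure_of quat_polynomials = little_bloch_space"
proof
  show "bloch_topology closure_of quat_polynomials \<subseteq> little_bloch_space"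
    using closure_of_mono[OF quat_polynomials_subset_little_bloch_space] closure_of_little_bloch_space
    by metis
  show "little_bloch_space \<subseteq> bloch_topology closure_of quat_polynomials"
  proof
    fix f assume f: "f \<in> little_bloch_space"
    have "\<exists>g\<in>quat_polynomials \<inter> bloch_space. bloch_dist f g < e" if "e > 0" for e
    proof -
      \<comment> \<open>Any fraction below \<open>e / 3\<close> turns the non-strict bound into a
        strict one.\<close>
      obtain N c where "bloch_dist f (quat_poly N c) \<le> 3 * (e / 4)"
        using little_bloch_space_approx[OF f, of "e / 4"] \<open>e > 0\<close> by auto
      also have "\<dots> < e"
        using \<open>e > 0\<close> by simp
      finally show ?thesis
        using quat_poly_in_bloch_space by (auto simp: quat_polynomials_eq)
    qed
    then show "f \<in> bloch_topology closure_of quat_polynomials"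
      using f by (simp add: bloch_closure_iff little_bloch_space_def)
  qed
qed

section \<open>Separability through polynomials with coefficients in a countable dense set\<close>

lemma bloch_dist_quat_poly_le:
  "bloch_dist (quat_poly n a) (quat_poly n b) \<le> (\<Sum>k\<le>n. real (Suc k) * norm (a k - b k))"
proof -
  have "bloch_dist (quat_poly n a) (quat_poly n b)
    \<le> norm (quat_poly n a 0 - quat_poly n b 0) + (\<Sum>k\<le>n. real k * norm (a k - b k))"
  proof (intro bloch_dist_le quat_poly_in_bloch_space)
    fix q :: quat assume q: "q \<in> quat_ball"
    have "partial_x0 (quat_poly n a) q - partial_x0 (quat_poly n b) q
      = partial_x0 (quat_poly n (\<lambda>k. a k - b k)) q"
      by (simp add: partial_x0_quat_poly[OF q] right_diff_distrib scaleR_diff_right sum_subtractf)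
    then have "norm (partial_x0 (quat_poly n a) q - partial_x0 (quat_poly n b) q)
      \<le> (\<Sum>k\<le>n. real k * norm (a k - b k))"
      using norm_partial_x0_quat_poly_le[OF q] by simp
    moreover have "(1 - (norm q)\<^sup>2) * norm (partial_x0 (quat_poly n a) q - partial_x0 (quat_poly n b) q)
      \<le> norm (partial_x0 (quat_poly n a) q - partial_x0 (quat_poly n b) q)"
      using ball_weight_pos[OF q] by (intro mult_left_le_one_le) auto
    ultimately show "(1 - (norm q)\<^sup>2) * norm (partial_x0 (quat_poly n a) q - partial_x0 (quat_poly n b) q)
      \<le> (\<Sum>k\<le>n. real k * norm (a k - b k))"
      by linarith
  qed
  \<comment> \<open>Enlarging the single difference at index 0 to the whole sum merges both
    contributions into the weights \<open>Suc k\<close>.\<close>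
  also have "norm (quat_poly n a 0 - quat_poly n b 0) \<le> (\<Sum>k\<le>n. norm (a k - b k))"
    by (simp add: quat_poly_0 member_le_sum[of 0 "{..n}" "\<lambda>k. norm (a k - b k)"])
  finally show ?thesis
    by (simp add: sum.distrib algebra_simps)
qed

lemma countable_dense_quat_polynomials:
  obtains S where "countable S" "S \<subseteq> quat_polynomials"
    "quat_polynomials \<subseteq> bloch_topology closure_of S"
proof -
  obtain D :: "quat set" where D: "countable D" "\<And>X. open X \<Longrightarrow> X \<noteq> {} \<Longrightarrow> \<exists>d\<in>D. d \<in> X"
    using countable_dense_setE by blast
  \<comment> \<open>Finite lists over \<open>D\<close> are countable, unlike infinite coefficient
    sequences. The empty list yields a constant polynomial with the unspecified coefficient
    \<open>[] ! 0\<close>, which still belongs to \<open>quat_polynomials\<close>.\<close>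
  define S where "S = (\<lambda>xs. quat_poly (length xs - 1) (nth xs)) ` lists D"
  have "countable S"
    unfolding S_def by (intro countable_image countable_lists D(1))
  moreover have sub: "S \<subseteq> quat_polynomials"
    by (auto simp: S_def quat_polynomials_eq)
  moreover have "quat_polynomials \<subseteq> bloch_topology closure_of S"
  proof
    fix f assume "f \<in> quat_polynomials"
    then obtain n a where f: "f = quat_poly n a"
      by (auto simp: quat_polynomials_eq)
    have "\<exists>g\<in>S \<inter> bloch_space. bloch_dist f g < e" if e: "e > 0" for e
    proof -
      \<comment> \<open>\<open>Suc k\<close> cancels the weight of index \<open>k\<close>;
        \<open>n + 2\<close> exceeds the number \<open>n + 1\<close> of summands, which makes the
        total strictly less than \<open>e\<close>.\<close>
      have "\<exists>d\<in>D. norm (a k - d) < e / (real (n + 2) * real (Suc k))" for k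
      proof -
        have "0 < e / (real (n + 2) * real (Suc k))"
          using e by (intro divide_pos_pos mult_pos_pos) auto
        then have "ball (a k) (e / (real (n + 2) * real (Suc k))) \<noteq> {}"
          unfolding ball_eq_empty by (simp only: not_le)
        from D(2)[OF open_ball this] show ?thesis
          by (simp only: mem_ball dist_norm)
      qed
      then obtain d where d: "\<And>k. d k \<in> D" "\<And>k. norm (a k - d k) < e / (real (n + 2) * real (Suc k))"
        by metis
      \<comment> \<open>Length \<open>Suc n\<close> makes \<open>length xs - 1\<close> equal to
        \<open>n\<close>.\<close>
      define xs where "xs = map d [0..<Suc n]"
      have eq: "quat_poly n d = quat_poly (length xs - 1) (nth xs)"
        unfolding quat_poly_def by (intro restrict_ext sum.cong) (auto simp: xs_def nth_map_upt simp del: upt_Suc)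
      have "xs \<in> lists D"
        using d(1) by (auto simp: xs_def)
      then have "quat_poly n d \<in> S"
        unfolding S_def eq by (rule imageI)
      moreover have "bloch_dist f (quat_poly n d) < e"
      proof -
        have "bloch_dist f (quat_poly n d) \<le> (\<Sum>k\<le>n. real (Suc k) * norm (a k - d k))"
          unfolding f by (rule bloch_dist_quat_poly_le)
        also have "\<dots> \<le> (\<Sum>k\<le>n. e / real (n + 2))"
        proof (rule sum_mono)
          fix k
          have "norm (a k - d k) < e / real (n + 2) / real (Suc k)"
            using d(2)[of k] by (simp only: divide_divide_eq_left)
          then have "norm (a k - d k) * real (Suc k) < e / real (n + 2)"
            by (simp only: pos_less_divide_eq of_nat_0_less_iff zero_less_Suc)
          then show "real (Suc k) * norm (a k - d k) \<le> e / real (n + 2)"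
            by (simp only: mult.commute less_imp_le)
        qed
        also have "\<dots> < e"
          using e by (simp add: field_simps)
        finally show ?thesis .
      qed
      ultimately show ?thesis
        using quat_poly_in_bloch_space by blast
    qed
    then show "f \<in> bloch_topology closure_of S"
      by (simp add: bloch_closure_iff f quat_poly_in_bloch_space)
  qed
  ultimately show ?thesis
    using that by blast
qed

theorem proposition2p23:
  shows "bloch_topology closure_of quat_polynomials = little_bloch_space
    \<and> separable_space (subtopology bloch_topology little_bloch_space)"
proof
  show "bloch_topology closure_of quat_polynomials = little_bloch_space"
    by (rule closure_of_quat_polynomials)
  obtain S where S: "countable S" "S \<subseteq> quat_polynomials"
    "quat_polynomials \<subseteq> bloch_topology closure_of S"
    by (rule countable_dense_quat_polynomials)
  have SL: "S \<subseteq> little_bloch_space"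
    using S(2) quat_polynomials_subset_little_bloch_space by blast
  have "little_bloch_space \<subseteq> bloch_topology closure_of S"
    \<comment> \<open>The closure of \<open>S\<close> is closed and contains the polynomials, hence
      also their closure.\<close>
    using closure_of_minimal[OF S(3) closedin_closure_of] closure_of_quat_polynomials by simp
  moreover have "topspace (subtopology bloch_topology little_bloch_space) = little_bloch_space"
    by (auto simp: topspace_bloch_topology little_bloch_space_def)
  ultimately show "separable_space (subtopology bloch_topology little_bloch_space)"
    using S(1) SL unfolding separable_space_def
    by (intro exI[of _ S]) (auto simp: closure_of_subtopology Int_absorb1 Int_absorb2)
qed

end
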